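(* Let $d\ge 1$ and $n\ge 2$ be integers, let $\mathbb{Z}^d$ be equipped with the standard generating set $S=\{\pm e_1,\dots,\pm e_d\}$, and let $\mathcal{G}$ be the Schreier graph (with respect to $S$) induced by the free part of the shift action $\mathbb{Z}^d\curvearrowright n^{\mathbb{Z}^d}$. Then $D_B(\mathcal{G})\le n+1$.
   Context: Here $n=\{0,\dots,n-1\}$ is a discrete alphabet and $n^{\mathbb{Z}^d}$ carries the product Borel structure. The shift action is $(g\cdot x)(h)=x(h+g)$. The free part is $X=\{x\in n^{\mathbb{Z}^d} : g\cdot x\neq x \text{ for all } g\neq 0\}$. The Schreier graph $\mathcal{G}=(X,E)$ has vertex set $X$ and edges $x\,E\,y\iff x\neq y$ and $s\cdot x=y$ for some $s\in S$. For a Borel graph $\mathcal{G}=(X,E)$ ($X$ a standard Borel space, $E\subseteq X\times X$ Borel, symmetric, irreflexive), a Borel distinguishing $Y$-coloring is a Borel map $c:X\to Y$ into a standard Borel space $Y$ such that $c\circ\psi\neq c$ for every non-identity graph automorphism $\psi$ of $\mathcal{G}$ (not necessarily Borel). The Borel distinguishing number $D_B(\mathcal{G})$ is the minimum cardinality $|Y|$ of a standard Borel space $Y$ for which a Borel distinguishing $Y$-coloring exists. *)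

theory Defs
  imports "HOL-Analysis.Analysis"
begin

unbundle cardinal_syntax

section \<open>Borel graphs and the Borel distinguishing number\<close>

text \<open>
  Measurable spaces are represented by the type \<^typ>\<open>'a measure\<close>; only the carrier and the
  sigma-algebra matter, never the measure.
\<close>

definition standard_borel :: "'a measure \<Rightarrow> bool" where
  "standard_borel M \<longleftrightarrow>
     (\<exists>T. topspace T = space M \<and> completely_metrizable_space T \<and> second_countable T \<and>
          sets M = sigma_sets (topspace T) {U. openin T U})"

definition borel_graph :: "'a measure \<Rightarrow> ('a \<times> 'a) set \<Rightarrow> bool" where
  "borel_graph M E \<longleftrightarrow> standard_borel M \<and> E \<in> sets (M \<Otimes>\<^sub>M M) \<and> sym E \<and> irrefl E"

text \<open>
  Functions are total in HOL, so a vertex map matters only through its values on the vertex set;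
  equality with the identity (and of colorings, below) is therefore tested on that set.
\<close>

definition graph_automorphism :: "'a set \<Rightarrow> ('a \<times> 'a) set \<Rightarrow> ('a \<Rightarrow> 'a) \<Rightarrow> bool" where
  "graph_automorphism X E \<psi> \<longleftrightarrow>
     bij_betw \<psi> X X \<and> (\<forall>x\<in>X. \<forall>y\<in>X. (x, y) \<in> E \<longleftrightarrow> (\<psi> x, \<psi> y) \<in> E)"

definition borel_distinguishing_coloring ::
    "'a measure \<Rightarrow> ('a \<times> 'a) set \<Rightarrow> 'c measure \<Rightarrow> ('a \<Rightarrow> 'c) \<Rightarrow> bool" where
  "borel_distinguishing_coloring M E Y c \<longleftrightarrow>
     standard_borel Y \<and> c \<in> measurable M Y \<and>
     (\<forall>\<psi>. graph_automorphism (space M) E \<psi> \<longrightarrow> (\<exists>x\<in>space M. \<psi> x \<noteq> x) \<longrightarrow>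
          (\<exists>x\<in>space M. c (\<psi> x) \<noteq> c x))"

text \<open>
  The possible cardinalities of color spaces. HOL cannot quantify over all types, so color spaces
  are taken with carrier a set of reals and an arbitrary standard Borel structure on it. Nothing
  is lost: a standard Borel space has at most continuum many points, so it can be transported
  along an injection into the reals.
\<close>

definition borel_distinguishing_cardinals :: "'a measure \<Rightarrow> ('a \<times> 'a) set \<Rightarrow> real rel set" where
  "borel_distinguishing_cardinals M E =
     {|space Y| | Y :: real measure. \<exists>c. borel_distinguishing_coloring M E Y c}"

text \<open>
  The least of them, as a cardinal in the sense of the HOL cardinal library. A choice operator is
  needed since cardinals are well-order relations, determined only up to order isomorphism.
\<close>

definition borel_distinguishing_number :: "'a measure \<Rightarrow> ('a \<times> 'a) set \<Rightarrow> real rel" where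
  "borel_distinguishing_number M E =
     (SOME r. r \<in> borel_distinguishing_cardinals M E \<and>
              (\<forall>r'\<in>borel_distinguishing_cardinals M E. r \<le>o r'))"

lemma borel_distinguishing_number_minimum:
  assumes "borel_distinguishing_cardinals M E \<noteq> {}"
  shows "borel_distinguishing_number M E \<in> borel_distinguishing_cardinals M E"
    and "\<And>r. r \<in> borel_distinguishing_cardinals M E \<Longrightarrow> borel_distinguishing_number M E \<le>o r"
proof -
  have "\<forall>r\<in>borel_distinguishing_cardinals M E. Card_order r"
    by (auto simp: borel_distinguishing_cardinals_def card_of_Card_order)
  from exists_minim_Card_order[OF assms this]
  have "\<exists>r. r \<in> borel_distinguishing_cardinals M E \<and>
            (\<forall>r'\<in>borel_distinguishing_cardinals M E. r \<le>o r')"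
    by blast
  from someI_ex[OF this]
  show "borel_distinguishing_number M E \<in> borel_distinguishing_cardinals M E"
    and "\<And>r. r \<in> borel_distinguishing_cardinals M E \<Longrightarrow> borel_distinguishing_number M E \<le>o r"
    unfolding borel_distinguishing_number_def by blast+
qed

section \<open>The Schreier graph of the free part of the shift\<close>

text \<open>
  The group is \<^typ>\<open>int ^ 'd\<close>, with \<open>'d\<close> an arbitrary finite (hence nonempty) index type, so
  that \<open>d = CARD('d) \<ge> 1\<close>.
\<close>

definition config_space :: "nat \<Rightarrow> (int ^ 'd \<Rightarrow> nat) measure" where
  "config_space n = Pi\<^sub>M UNIV (\<lambda>_. count_space {..<n})"

definition shift :: "int ^ 'd \<Rightarrow> (int ^ 'd \<Rightarrow> nat) \<Rightarrow> (int ^ 'd \<Rightarrow> nat)" where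
  "shift g x = (\<lambda>h. x (h + g))"

definition free_part :: "nat \<Rightarrow> (int ^ 'd \<Rightarrow> nat) measure" where
  "free_part n =
     restrict_space (config_space n) {x \<in> space (config_space n). \<forall>g. g \<noteq> 0 \<longrightarrow> shift g x \<noteq> x}"

definition standard_generators :: "(int ^ 'd) set" where
  "standard_generators = (\<Union>i. {axis i 1, - axis i 1})"

definition schreier_edges ::
    "(int ^ 'd) set \<Rightarrow> nat \<Rightarrow> ((int ^ 'd \<Rightarrow> nat) \<times> (int ^ 'd \<Rightarrow> nat)) set" where
  "schreier_edges S n =
     {(x, y). x \<in> space (free_part n) \<and> y \<in> space (free_part n) \<and>
              x \<noteq> y \<and> (\<exists>s\<in>S. shift s x = y)}"

lemma space_free_part:
  "space (free_part n :: (int ^ 'd \<Rightarrow> nat) measure) =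
     {x. (\<forall>h. x h < n) \<and> (\<forall>g. g \<noteq> 0 \<longrightarrow> shift g x \<noteq> x)}"
  by (auto simp: free_part_def config_space_def space_restrict_space space_PiM)

lemma sets_free_part:
  "sets (free_part n :: (int ^ 'd \<Rightarrow> nat) measure) =
     sets (restrict_space borel (space (free_part n)))"
proof -
  let ?X = "space (free_part n :: (int ^ 'd \<Rightarrow> nat) measure)"
  have b: "sets (borel :: nat measure) = UNIV"
    by (metis Pow_UNIV measurable_ident_sets sets_borel_eq_count_space sets_count_space)
  have 1: "(\<lambda>x. x) \<in> measurable (free_part n :: (int ^ 'd \<Rightarrow> nat) measure) (restrict_space borel ?X)"
  proof (rule measurable_restrict_space2)
    have "(\<lambda>x. x h) \<in> measurable (free_part n :: (int ^ 'd \<Rightarrow> nat) measure) borel" for h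
      unfolding free_part_def config_space_def
      by (rule measurable_restrict_space1, rule measurable_compose[OF measurable_component_singleton]) (auto simp: measurable_count_space_eq1)
    then show "(\<lambda>x. x) \<in> measurable (free_part n :: (int ^ 'd \<Rightarrow> nat) measure) borel"
      by (intro measurable_coordinatewise_then_product) auto
  qed auto
  have 2: "(\<lambda>x. x) \<in> measurable (restrict_space borel ?X) (free_part n :: (int ^ 'd \<Rightarrow> nat) measure)"
    unfolding free_part_def
  proof (rule measurable_restrict_space2, fold free_part_def)
    show "(\<lambda>x. x) \<in> space (restrict_space borel ?X) \<rightarrow> {x \<in> space (config_space n). \<forall>g. g \<noteq> 0 \<longrightarrow> shift g x \<noteq> x}"
      by (auto simp: space_restrict_space space_free_part config_space_def space_PiM)
    have m: "(\<lambda>x. x h) \<in> measurable (borel :: (int ^ 'd \<Rightarrow> nat) measure) borel" for h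
      using measurable_product_coordinates by auto
    show "(\<lambda>x. x) \<in> measurable (restrict_space borel ?X) (config_space n)"
      unfolding config_space_def
    proof (rule measurable_PiM_single')
      fix h :: "int ^ 'd"
      show "(\<lambda>x. x h) \<in> measurable (restrict_space borel ?X) (count_space {..<n})"
      proof (subst measurable_count_space_eq2, simp, safe)
        fix a show "(\<lambda>x. x h) -` {a} \<inter> space (restrict_space borel ?X) \<in> sets (restrict_space borel ?X)"
          by (intro measurable_sets[OF measurable_restrict_space1[OF m]]) (simp add: b)
      qed (auto simp: space_restrict_space space_free_part)
    qed (auto simp: space_restrict_space space_free_part)
  qed
  show ?thesis
  proof safe
    fix A assume A: "A \<in> sets (free_part n :: (int ^ 'd \<Rightarrow> nat) measure)"
    from measurable_sets[OF 2 A] show "A \<in> sets (restrict_space borel ?X)"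
      using sets.sets_into_space[OF A] by (simp add: space_restrict_space Int_absorb2)
  next
    fix A assume A: "A \<in> sets (restrict_space borel ?X)"
    from measurable_sets[OF 1 A] show "A \<in> sets (free_part n)"
      using sets.sets_into_space[OF A] by (simp add: space_restrict_space Int_absorb2)
  qed
qed

lemma standard_borel_free_part: "standard_borel (free_part n :: (int ^ 'd \<Rightarrow> nat) measure)"
proof -
  let ?X = "space (free_part n :: (int ^ 'd \<Rightarrow> nat) measure)"
  let ?T = "euclidean :: (int ^ 'd \<Rightarrow> nat) topology"
  have disc: "(euclidean :: nat topology) = discrete_topology UNIV"
    by (rule topology_eq[THEN iffD2]) (auto simp: open_discrete)
  have cm: "completely_metrizable_space ?T"
    unfolding euclidean_product_topology[symmetric]
    by (subst completely_metrizable_space_product_topology)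
       (auto simp: disc completely_metrizable_space_discrete_topology)
  have o: "open {x :: int ^ 'd \<Rightarrow> nat. P (x a) (x b)}" for P a b
  proof -
    have "open {x :: int ^ 'd \<Rightarrow> nat. x a = i \<and> x b = j}" for i j
    proof -
      have "open ((\<lambda>x :: int ^ 'd \<Rightarrow> nat. x a) -` {i} \<inter> (\<lambda>x. x b) -` {j})"
        by (intro open_Int open_vimage continuous_on_product_coordinates)
           (auto simp: open_discrete intro: continuous_on_product_coordinates)
      then show ?thesis by (simp add: vimage_def Int_def)
    qed
    then have "open (\<Union>i. \<Union>j \<in> {j. P i j}. {x :: int ^ 'd \<Rightarrow> nat. x a = i \<and> x b = j})"
      by blast
    moreover have "(\<Union>i. \<Union>j \<in> {j. P i j}. {x :: int ^ 'd \<Rightarrow> nat. x a = i \<and> x b = j}) = {x. P (x a) (x b)}"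
      by auto
    ultimately show ?thesis by simp
  qed
  have g1: "gdelta_in ?T {x. x h < n}" for h
    using o[of "\<lambda>i j. i < n" h h] by (intro open_imp_gdelta_in) simp
  have g2: "open {x. g \<noteq> 0 \<longrightarrow> shift g x \<noteq> x}" for g :: "int ^ 'd"
  proof -
    have "{x. g \<noteq> 0 \<longrightarrow> shift g x \<noteq> x} =
        (if g = 0 then UNIV else (\<Union>h. {x. x (h + g) \<noteq> x h}))"
      by (auto simp: shift_def fun_eq_iff)
    moreover have "open \<dots>"
      using o[of "(\<noteq>)"] by auto
    ultimately show ?thesis by simp
  qed
  have "gdelta_in ?T (\<Inter> (range (\<lambda>h. {x. x h < n}) \<union> range (\<lambda>g. {x. g \<noteq> 0 \<longrightarrow> shift g x \<noteq> x})))"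
    by (rule gdelta_in_Inter) (use g1 g2 in \<open>auto intro: open_imp_gdelta_in\<close>)
  moreover have "\<Inter> (range (\<lambda>h. {x. x h < n}) \<union> range (\<lambda>g. {x. g \<noteq> 0 \<longrightarrow> shift g x \<noteq> x})) = ?X"
    by (auto simp: space_free_part)
  ultimately have cX: "completely_metrizable_space (subtopology ?T ?X)"
    using completely_metrizable_space_gdelta_in[OF cm] by simp
  have X_borel: "?X \<in> sets borel"
  proof -
    have "{x :: int ^ 'd \<Rightarrow> nat. x h < n} \<in> sets borel" for h
      using o[of "\<lambda>i j. i < n" h h] by (intro borel_open) simp
    moreover have "{x. g \<noteq> 0 \<longrightarrow> shift g x \<noteq> x} \<in> sets borel" for g :: "int ^ 'd"
      using g2 by (intro borel_open) simp
    ultimately have "(\<Inter>h. {x :: int ^ 'd \<Rightarrow> nat. x h < n}) \<inter>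
        (\<Inter>g. {x :: int ^ 'd \<Rightarrow> nat. g \<noteq> 0 \<longrightarrow> shift g x \<noteq> x}) \<in> sets borel"
      by (intro sets.Int sets.countable_INT'') auto
    also have "(\<Inter>h. {x :: int ^ 'd \<Rightarrow> nat. x h < n}) \<inter> (\<Inter>g. {x :: int ^ 'd \<Rightarrow> nat. g \<noteq> 0 \<longrightarrow> shift g x \<noteq> x}) = ?X" by (auto simp: space_free_part)
    finally show ?thesis .
  qed
  have "second_countable ?T"
  proof -
    obtain B :: "(int ^ 'd \<Rightarrow> nat) set set" where "countable B" "topological_basis B"
      using ex_countable_basis by blast
    then show ?thesis
      unfolding second_countable_def
      by (intro exI[of _ B]) (metis open_openin topological_basisE topological_basis_open)
  qed
  then have sX: "second_countable (subtopology ?T ?X)"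
    by (rule second_countable_subtopology)
  have "sets (free_part n) = sigma_sets ?X {U. openin (subtopology ?T ?X) U}"
  proof -
    have "sets (free_part n) = (\<inter>) ?X ` sigma_sets UNIV {U. open U}"
      unfolding sets_free_part sets_restrict_space by (simp add: borel_def)
    also have "\<dots> = sigma_sets ?X ((\<inter>) ?X ` {U. open U})"
      by (rule sigma_sets_Int[OF _ subset_UNIV]) (use X_borel in \<open>simp add: borel_def\<close>)
    also have "(\<inter>) ?X ` {U. open U} = {U. openin (subtopology ?T ?X) U}"
      by (auto simp: openin_subtopology)
    finally show ?thesis .
  qed
  with cX sX show ?thesis
    unfolding standard_borel_def by (intro exI[of _ "subtopology ?T ?X"]) simp
qed

lemma borel_graph_schreier:
  "borel_graph (free_part n :: (int ^ 'd \<Rightarrow> nat) measure) (schreier_edges standard_generators n)"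
proof -
  let ?M = "free_part n :: (int ^ 'd \<Rightarrow> nat) measure"
  have co: "(\<lambda>x. x h) \<in> measurable ?M (count_space UNIV)" for h
    unfolding free_part_def config_space_def
    by (rule measurable_restrict_space1, rule measurable_compose[OF measurable_component_singleton])
       (auto simp: measurable_count_space_eq1)
  have "schreier_edges standard_generators n =
      {p \<in> space (?M \<Otimes>\<^sub>M ?M). (\<exists>h. fst p h \<noteq> snd p h) \<and>
        (\<exists>s. s \<in> standard_generators \<and> (\<forall>h. fst p (h + s) = snd p h))}"
    by (auto simp: schreier_edges_def space_pair_measure shift_def fun_eq_iff; blast)
  also have "\<dots> \<in> sets (?M \<Otimes>\<^sub>M ?M)"
  proof -
    have eq: "Measurable.pred (?M \<Otimes>\<^sub>M ?M) (\<lambda>p. fst p g = snd p h)" for g h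
    proof -
      have 1: "(\<lambda>p. fst p g) \<in> measurable (?M \<Otimes>\<^sub>M ?M) (count_space UNIV)"
        by (rule measurable_compose[OF measurable_fst co])
      have 2: "(\<lambda>p. snd p h) \<in> measurable (?M \<Otimes>\<^sub>M ?M) (count_space UNIV)"
        by (rule measurable_compose[OF measurable_snd co])
      have "Measurable.pred (?M \<Otimes>\<^sub>M ?M) (\<lambda>p. \<exists>k. fst p g = k \<and> snd p h = k)"
        by (intro pred_intros_logic pred_intros_countable pred_eq_const1[OF 1] pred_eq_const1[OF 2]) auto
      then show ?thesis by (simp add: eq_commute)
    qed
    have "Measurable.pred (?M \<Otimes>\<^sub>M ?M) (\<lambda>p. (\<exists>h. \<not> fst p h = snd p h) \<and>
        (\<exists>s. s \<in> standard_generators \<and> (\<forall>h. fst p (h + s) = snd p h)))"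
      by (intro pred_intros_logic pred_intros_countable eq measurable_const) simp
    then show ?thesis by (simp add: pred_def)
  qed
  finally have "schreier_edges standard_generators n \<in> sets (?M \<Otimes>\<^sub>M ?M)" .
  moreover have "- s \<in> standard_generators" if "s \<in> standard_generators" for s :: "int ^ 'd"
    using that by (auto simp: standard_generators_def)
  then have "sym (schreier_edges (standard_generators :: (int ^ 'd) set) n)"
    by (fastforce simp: sym_def schreier_edges_def shift_def)
  moreover have "irrefl (schreier_edges (standard_generators :: (int ^ 'd) set) n)"
    by (auto simp: irrefl_def schreier_edges_def)
  ultimately show ?thesis
    using standard_borel_free_part by (auto simp: borel_graph_def)
qed

end

theory Submission
  imports Defs
begin

text \<open>
  The colouring \<open>x \<mapsto> x 0\<close> reads off the whole configuration \<open>x\<close> along its orbit, so the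
  only nontrivial automorphisms that can preserve it are those acting on some orbit with a
  nontrivial signed permutation of the axes.
  The extra colour \<open>n\<close> serves to break this symmetry without losing information. In each orbit
  one chooses, in a Borel way, a nonempty set of markers that are far apart, and near every marker
  \<open>m\<close> the pattern of \<open>x\<close> on a finite block \<open>m + B\<close> is replaced by its image under an injection
  \<open>\<Phi>\<close> from \<open>n\<close>-coloured to \<open>(n + 1)\<close>-coloured patterns, such that the cells of colour \<open>n\<close> form
  a star: the marker and one point on each positive axis and on one negative axis, all at different
  distances. An isometry of the grid that carries a star to a star must fix its centre and all axes.
  Hence a colour-preserving automorphism is a translation on each orbit and respects markers, and
  by injectivity of \<open>\<Phi>\<close> it fixes the configuration.
\<close>

section \<open>Automorphisms of the grid\<close>

definition l1 :: "int ^ 'd \<Rightarrow> int" where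
  "l1 g = (\<Sum>i\<in>UNIV. \<bar>g $ i\<bar>)"

lemma l1_triangle: "l1 (g + h) \<le> l1 g + l1 h"
  by (auto simp: l1_def sum.distrib[symmetric] intro!: sum_mono)

lemma l1_minus [simp]: "l1 (- g) = l1 g"
  by (simp add: l1_def)

lemma l1_triangle_minus: "l1 (g - h) \<le> l1 g + l1 h"
  using l1_triangle[of g "- h"] by simp

lemma l1_zero [simp]: "l1 0 = 0"
  by (simp add: l1_def)

lemma l1_eq_0 [simp]: "l1 g = 0 \<longleftrightarrow> g = 0"
  by (simp add: l1_def sum_nonneg_eq_0_iff vec_eq_iff)

lemma l1_nonneg [simp]: "0 \<le> l1 g"
  by (simp add: l1_def sum_nonneg)

lemma l1_axis [simp]: "l1 (axis i a) = \<bar>a\<bar>"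
  by (simp add: l1_def axis_def if_distrib[of abs] cong: if_cong)

lemma finite_l1_ball: "finite {g :: int ^ 'd. l1 g \<le> R}"
proof -
  have "\<bar>g $ i\<bar> \<le> l1 g" for g :: "int ^ 'd" and i
    unfolding l1_def by (rule member_le_sum) auto
  then have "{g :: int ^ 'd. l1 g \<le> R} \<subseteq> vec_lambda ` (UNIV \<rightarrow> {-R..R})"
    by (auto intro!: image_eqI[of _ vec_lambda "vec_nth _"] simp: abs_le_iff)
       (smt (verit, best))+
  moreover have "finite (UNIV \<rightarrow> {-R..R} :: ('d \<Rightarrow> int) set)"
    using finite_PiE[of "UNIV :: 'd set" "\<lambda>_. {-R..R}"] by (simp add: PiE_UNIV_domain Pi_def)
  ultimately show ?thesis
    by (meson finite_imageI finite_subset)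
qed

lemma mem_standard_generators:
  "s \<in> standard_generators \<longleftrightarrow> (\<exists>i a. s = axis i a \<and> \<bar>a\<bar> = 1)"
proof
  assume "\<exists>i a. s = axis i a \<and> \<bar>a\<bar> = 1"
  then obtain i a where "s = axis i a" "a = 1 \<or> a = - 1" by (auto simp: abs_if split: if_splits)
  moreover have "axis i (- 1) = - axis i (1 :: int)" by (simp add: vec_eq_iff axis_def)
  ultimately show "s \<in> standard_generators" by (auto simp: standard_generators_def)
next
  assume "s \<in> standard_generators"
  moreover have "- axis i (1 :: int) = axis i (- 1)" for i :: 'a by (simp add: vec_eq_iff axis_def)
  ultimately show "\<exists>i a. s = axis i a \<and> \<bar>a\<bar> = 1"
    by (fastforce simp: standard_generators_def)
qed

lemma axis_in_standard_generators: "\<bar>a\<bar> = 1 \<Longrightarrow> axis i a \<in> standard_generators"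
  unfolding mem_standard_generators by blast

lemma uminus_standard_generators [simp]:
  "- s \<in> standard_generators \<longleftrightarrow> s \<in> standard_generators"
  unfolding standard_generators_def by (auto simp: minus_equation_iff[of s])

lemma l1_standard_generator: "s \<in> standard_generators \<Longrightarrow> l1 s = 1"
  by (auto simp: mem_standard_generators)

text \<open>A sum of two generators determines the unordered pair, unless the sum is 0.\<close>

lemma standard_generators_diff_cases:
  fixes s t u v :: "int ^ 'd"
  assumes "s \<in> standard_generators" "t \<in> standard_generators"
    "u \<in> standard_generators" "v \<in> standard_generators"
    and "s \<noteq> t" and eq: "s + u = t + v"
  shows "u = t \<and> v = s \<or> u = - s \<and> v = - t"
proof -
  from assms(1-4)[unfolded mem_standard_generators]
  obtain i j k l :: 'd and a b c e :: int where
    *: "s = axis i a" "t = axis j b" "u = axis k c" "v = axis l e"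
    "\<bar>a\<bar> = 1" "\<bar>b\<bar> = 1" "\<bar>c\<bar> = 1" "\<bar>e\<bar> = 1" by metis
  have **: "(if m = i then a else 0) + (if m = k then c else 0) =
      (if m = j then b else 0) + (if m = l then e else 0)" for m
    using arg_cong[OF eq, of "\<lambda>f. f $ m"] by (auto simp: * axis_def)
  have "i \<noteq> j \<or> a \<noteq> b" using \<open>s \<noteq> t\<close> * by auto
  moreover have neg: "- axis m z = axis m (- z)" for m :: 'd and z :: int
    by (simp add: vec_eq_iff axis_def)
  have "(k = j \<and> c = b \<and> l = i \<and> e = a) \<or> (k = i \<and> c = - a \<and> l = j \<and> e = - b)"
    using **[of i] **[of j] **[of k] **[of l] *(5-8) \<open>i \<noteq> j \<or> a \<noteq> b\<close>
    by (cases "i = j"; cases "i = k"; cases "i = l"; cases "j = k"; cases "j = l"; cases "k = l"; force)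
  then show ?thesis unfolding * neg by metis
qed

lemma sum_axis_components: "(\<Sum>i\<in>UNIV. axis i (g $ i)) = (g :: int ^ 'd)"
  by (simp add: vec_eq_iff axis_def)

text \<open>Coordinates are filled in one after another, each by unit steps along its axis in either
  direction.\<close>

lemma int_vec_induct [case_names zero add]:
  fixes g :: "int ^ 'd"
  assumes z: "P 0" and step: "\<And>g s. P g \<Longrightarrow> s \<in> standard_generators \<Longrightarrow> P (g + s)"
  shows "P g"
proof -
  have single: "P (h + axis i a)" if "P h" for h i a
  proof (induction a rule: int_induct[where k = 0])
    case base
    have "axis i (0 :: int) = 0" by (simp add: vec_eq_iff axis_def)
    then show ?case using that by (simp only: add_0_right)
  next
    case (step1 a)
    have e: "h + axis i (a + 1) = h + axis i a + axis i 1" by (simp add: vec_eq_iff axis_def)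
    show ?case unfolding e by (rule step[OF step1(2)]) (simp add: axis_in_standard_generators)
  next
    case (step2 a)
    have e: "h + axis i (a - 1) = h + axis i a + axis i (- 1)" by (simp add: vec_eq_iff axis_def)
    show ?case unfolding e by (rule step[OF step2(2)]) (simp add: axis_in_standard_generators)
  qed
  have "P (\<Sum>i\<in>I. axis i (g $ i))" for I :: "'d set"
    using finite[of I]
  proof (induction I)
    case (insert i I)
    then show ?case using single[OF insert(3), of i "g $ i"] by (simp add: add.commute)
  qed (simp add: z)
  then show "P g"
    by (metis sum_axis_components)
qed

text \<open>
  The common neighbours of \<open>g + s\<close> and \<open>g + t\<close> are \<open>g\<close> and \<open>g + s + t\<close>; this forces
  \<open>f\<close> to map squares to squares, and lines to lines (the case \<open>t = - s\<close>).
\<close>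

lemma grid_automorphism_affine:
  fixes f :: "int ^ 'd \<Rightarrow> int ^ 'd"
  assumes bij: "bij f"
    and adj: "\<And>g h. f g - f h \<in> standard_generators \<longleftrightarrow> g - h \<in> standard_generators"
  shows "f (g + h) = f g + f h - f 0"
proof -
  define D where "D g s = f (g + s) - f g" for g s
  have D: "D g s \<in> standard_generators" if "s \<in> standard_generators" for g s
    using that adj[of "g + s" g] by (simp add: D_def)
  have eq_iff: "f g = f h \<longleftrightarrow> g = h" for g h
    using bij by (auto simp: bij_def inj_def)
  have square: "f (g + s + t) = f g + D g s + D g t"
    if s: "s \<in> standard_generators" and t: "t \<in> standard_generators" and "s \<noteq> t" for g s t
  proof -
    have "D g s \<noteq> D g t" using \<open>s \<noteq> t\<close> eq_iff[of "g + s" "g + t"] by (simp add: D_def)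
    define u v where "u = D (g + s) t" and "v = D (g + t) s"
    have "D g s + u = D g t + v"
      by (simp add: u_def v_def D_def algebra_simps)
    moreover have "u \<in> standard_generators" "v \<in> standard_generators"
      using D s t by (auto simp: u_def v_def)
    ultimately have "u = D g t \<or> u = - D g s"
      using standard_generators_diff_cases[of "D g s" "D g t" u v] D s t \<open>D g s \<noteq> D g t\<close> by blast
    then show ?thesis
    proof
      assume "u = - D g s"
      then have "f (g + s + t) = f g" by (simp add: u_def D_def algebra_simps)
      then have "s + t = 0" using eq_iff[of "g + s + t" g] by (simp add: add.assoc)
      \<comment> \<open>Bijectivity supplies a preimage \<open>r\<close> of the expected fourth
        corner. It is a common neighbour of \<open>g + s\<close> and \<open>g + t\<close>, hence
        \<open>g\<close> or \<open>g + s + t\<close>, and these coincide here.\<close>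
      obtain r where r: "f r = f g + D g s + D g t"
        using bij by (metis bij_pointE)
      then have "f r - f (g + s) = D g t" "f r - f (g + t) = D g s"
        by (simp_all add: D_def)
      then have "r - (g + s) \<in> standard_generators" "r - (g + t) \<in> standard_generators"
        using D s t adj by metis+
      moreover have "s + (r - (g + s)) = t + (r - (g + t))" by (simp add: algebra_simps)
      ultimately have "r - (g + s) = t \<or> r - (g + s) = - s"
        using standard_generators_diff_cases[of s t] s t \<open>s \<noteq> t\<close> by blast
      then have "r = g + s + t \<or> r = g"
        by (auto simp: algebra_simps)
      with \<open>s + t = 0\<close> have "r = g + s + t" by (auto simp: add.assoc)
      with r show ?thesis by simp
    qed (simp add: u_def D_def algebra_simps)
  qed
  have neq_uminus: "s \<noteq> - s" if "s \<in> standard_generators" for s :: "int ^ 'd"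
    using that by (auto simp: mem_standard_generators vec_eq_iff axis_def)
  have D_shift: "D (g + t) s = D g s"
    if s: "s \<in> standard_generators" and t: "t \<in> standard_generators" for g s t
  proof (cases "s = t")
    case True
    \<comment> \<open>\<open>square\<close> excludes equal steps, so it is applied at
      \<open>g + s\<close> to the opposite pair \<open>s\<close>, \<open>- s\<close>.\<close>
    have "D g s = - D (g + s) (- s)" by (simp add: D_def)
    also have "\<dots> = D (g + s) s"
      using square[of s "- s" "g + s"] s neq_uminus[OF s] by (simp add: D_def algebra_simps)
    finally show ?thesis using True by simp
  next
    case False
    then show ?thesis using square[OF t s, of g] by (simp add: D_def algebra_simps)
  qed
  have D_0: "D g s = D 0 s" if "s \<in> standard_generators" for g s
    by (induction g rule: int_vec_induct) (simp_all add: D_shift that)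
  show ?thesis
  proof (induction h rule: int_vec_induct)
    case (add h s)
    have "f (k + s) = f k + D 0 s" for k
      unfolding D_0[OF add(2), of k, symmetric] by (simp add: D_def)
    from this[of "g + h"] this[of h] add(1) show ?case
      by (simp add: add.assoc)
  qed simp
qed

text \<open>A path changing one coordinate at a time joins \<open>h\<close> to \<open>g\<close> in
  \<open>l1 (g - h)\<close> steps, and each step is sent to a step.\<close>

lemma grid_automorphism_lipschitz:
  fixes f :: "int ^ 'd \<Rightarrow> int ^ 'd"
  assumes adj: "\<And>g s. s \<in> standard_generators \<Longrightarrow> f (g + s) - f g \<in> standard_generators"
  shows "l1 (f g - f h) \<le> l1 (g - h)"
proof -
  have single: "l1 (f (g + axis i a) - f g) \<le> \<bar>a\<bar>" for g i a
  proof (induction a rule: int_induct[where k = 0])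
    case base
    have "axis i (0 :: int) = (0 :: int ^ 'd)" by (simp add: vec_eq_iff axis_def)
    then show ?case by (simp only: add_0_right) simp
  next
    case (step1 a)
    have e: "g + axis i (a + 1) = g + axis i a + axis i 1" by (simp add: vec_eq_iff axis_def)
    have "l1 (f (g + axis i a + axis i 1) - f (g + axis i a)) = 1"
      by (intro l1_standard_generator adj) (simp add: axis_in_standard_generators)
    then show ?case
      using l1_triangle[of "f (g + axis i (a + 1)) - f (g + axis i a)" "f (g + axis i a) - f g"]
        step1 unfolding e by simp
  next
    case (step2 a)
    have e: "g + axis i (a - 1) = g + axis i a + axis i (- 1)" by (simp add: vec_eq_iff axis_def)
    have "l1 (f (g + axis i a + axis i (- 1)) - f (g + axis i a)) = 1"
      by (intro l1_standard_generator adj) (simp add: axis_in_standard_generators)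
    then show ?case
      using l1_triangle[of "f (g + axis i (a - 1)) - f (g + axis i a)" "f (g + axis i a) - f g"]
        step2 unfolding e by simp
  qed
  have "l1 (f (h + (\<Sum>i\<in>I. axis i ((g - h) $ i))) - f h) \<le> (\<Sum>i\<in>I. \<bar>(g - h) $ i\<bar>)"
    for I :: "'d set"
    using finite[of I]
  proof (induction I)
    case (insert i I)
    let ?k = "h + (\<Sum>i\<in>I. axis i ((g - h) $ i))"
    show ?case
      using insert single[of ?k i "(g - h) $ i"]
        l1_triangle[of "f (?k + axis i ((g - h) $ i)) - f ?k" "f ?k - f h"]
      by (simp add: algebra_simps)
  qed simp
  from this[of UNIV] show ?thesis
    unfolding sum_axis_components by (simp add: l1_def)
qed

text \<open>The Lipschitz bound applies to \<open>f\<close> and to its inverse.\<close>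

lemma grid_automorphism_isometry:
  fixes f :: "int ^ 'd \<Rightarrow> int ^ 'd"
  assumes bij: "bij f"
    and adj: "\<And>g h. f g - f h \<in> standard_generators \<longleftrightarrow> g - h \<in> standard_generators"
  shows "l1 (f g - f h) = l1 (g - h)"
proof (rule antisym)
  show "l1 (f g - f h) \<le> l1 (g - h)"
    by (rule grid_automorphism_lipschitz) (simp add: adj)
  have "inv f (g + s) - inv f g \<in> standard_generators" if "s \<in> standard_generators" for g s
    using that adj[of "inv f (g + s)" "inv f g"] bij by (simp add: bij_def surj_f_inv_f)
  then have "l1 (inv f (f g) - inv f (f h)) \<le> l1 (f g - f h)"
    by (rule grid_automorphism_lipschitz)
  then show "l1 (g - h) \<le> l1 (f g - f h)"
    using bij by (simp add: bij_def)
qed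

section \<open>Stars and block codes\<close>

text \<open>Numbering the axes from 1 keeps each leg off the centre; all lengths above the dimension
  remain free for the negative leg.\<close>

definition leg :: "'d::finite \<Rightarrow> nat" where
  "leg i = Suc (to_nat_on UNIV i)"

text \<open>
  Legs of pairwise different lengths along the positive axes, together with a leg along a
  negative axis, without which the star in dimension one would be a symmetric two-point set.
\<close>

definition star :: "nat \<Rightarrow> (int ^ 'd) set" where
  "star t = insert 0 (insert (axis undefined (- int t)) (range (\<lambda>i. axis i (int (leg i)))))"

lemma leg_pos [simp]: "0 < leg i"
  by (simp add: leg_def)

lemma leg_le: "leg (i :: 'd::finite) \<le> CARD('d)"
  using to_nat_on_finite[of "UNIV :: 'd set"] by (auto simp: leg_def bij_betw_def Suc_le_eq)

lemma leg_eq_iff [simp]: "leg i = leg j \<longleftrightarrow> i = j"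
  by (simp add: leg_def)

lemma zero_in_star [simp]: "0 \<in> star t"
  by (simp add: star_def)

lemma card_star_le: "card (star t :: (int ^ 'd) set) \<le> CARD('d) + 2"
proof -
  let ?L = "range (\<lambda>i :: 'd. axis i (int (leg i)))"
  have "card (star t :: (int ^ 'd) set) \<le> Suc (Suc (card ?L))"
    unfolding star_def by (intro order_trans[OF card_insert_le_m1] card_insert_le_m1) auto
  also have "card ?L \<le> CARD('d)"
    by (rule card_image_le) simp
  finally show ?thesis by simp
qed

lemma finite_star [simp]: "finite (star t)"
  by (simp add: star_def)

lemma l1_diff_opposite:
  assumes "\<And>k. u $ k * v $ k \<le> 0"
  shows "l1 (u - v) = l1 u + l1 v"
proof -
  have "\<bar>u $ k - v $ k\<bar> = \<bar>u $ k\<bar> + \<bar>v $ k\<bar>" for k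
    using assms[of k] by (auto simp: abs_if mult_le_0_iff)
  then show ?thesis by (simp add: l1_def sum.distrib)
qed

text \<open>Two distinct points lie on different axes or on opposite sides of one axis, or one is
  the centre. So a geodesic between them passes through the centre.\<close>

lemma l1_diff_star:
  assumes "u \<in> star t" "v \<in> star t" "u \<noteq> v"
  shows "l1 (u - v) = l1 u + l1 v"
proof (rule l1_diff_opposite)
  fix k show "u $ k * v $ k \<le> 0"
    using assms by (auto simp: star_def axis_def)
qed

text \<open>The negative leg is longer than every positive one, so the norm identifies the
  tip.\<close>

lemma star_l1_eq_leg:
  fixes u :: "int ^ 'd"
  assumes "u \<in> star t" "CARD('d) < t" "l1 u = int (leg i)"
  shows "u = axis i (int (leg i))"
  using assms leg_le[of i] leg_pos[of i] by (auto simp: star_def)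

text \<open>The negative leg ends in the only point with a negative coordinate, which reveals its
  length.\<close>

lemma star_inj:
  fixes t t' :: nat
  assumes "star t = (star t' :: (int ^ 'd) set)" "CARD('d) < t" "CARD('d) < t'"
  shows "t = t'"
proof -
  have "axis undefined (- int t) \<in> (star t' :: (int ^ 'd) set)"
    unfolding assms(1)[symmetric] by (simp add: star_def)
  then show ?thesis
    using assms(2,3) by (auto simp: star_def axis_eq_axis)
qed

text \<open>Even in dimension one there are two tips, and at most one of them is
  \<open>z\<close>.\<close>

lemma star_third_point:
  fixes z :: "int ^ 'd"
  assumes "CARD('d) < t"
  obtains v where "v \<in> star t" "v \<noteq> 0" "v \<noteq> z"
proof -
  let ?a = "axis undefined (int (leg (undefined :: 'd))) :: int ^ 'd"
  let ?b = "axis undefined (- int t) :: int ^ 'd"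
  have "?a \<noteq> ?b" using assms leg_pos[of "undefined :: 'd"] by (auto simp: axis_eq_axis)
  moreover have "?a \<noteq> 0" "?b \<noteq> 0" using assms leg_pos[of "undefined :: 'd"] by auto
  moreover have "?a \<in> star t" "?b \<in> star t" by (auto simp: star_def)
  ultimately show ?thesis using that by metis
qed

text \<open>Once the centre is fixed, \<open>f\<close> is additive, and lengths single out the tips
  of the positive legs. So every unit vector is fixed.\<close>

lemma star_rigid:
  fixes f :: "int ^ 'd \<Rightarrow> int ^ 'd"
  assumes affine: "\<And>g h. f (g + h) = f g + f h - f 0"
    and iso: "\<And>g h. l1 (f g - f h) = l1 (g - h)"
    and img: "f ` star t = star t'" and t: "CARD('d) < t" "CARD('d) < t'"
  shows "f g = g"
proof -
  \<comment> \<open>The centre is the only point of a star lying on geodesics between any two others.\<close>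
  have f0: "f 0 = 0"
  proof (rule ccontr)
    define z where "z = f 0"
    assume "f 0 \<noteq> 0"
    then have z: "z \<noteq> 0" "z \<in> star t'"
      using img by (auto simp: z_def)
    obtain u where u: "u \<in> star t" "f u = 0"
      using img zero_in_star[of t'] by (metis imageE)
    obtain v' where v': "v' \<in> star t'" "v' \<noteq> 0" "v' \<noteq> z"
      using star_third_point t(2) by metis
    then obtain v where v: "v \<in> star t" "f v = v'"
      using img by (metis imageE)
    have "u \<noteq> v" using u v v' by auto
    \<comment> \<open>Measuring through the centre of the first star, then of the second, gives
      \<open>l1 v' = 2 * l1 z + l1 v'\<close>.\<close>
    have "l1 v' = l1 (f u - f v)" using u v by simp
    also have "\<dots> = l1 u + l1 v"
      using l1_diff_star[OF u(1) v(1) \<open>u \<noteq> v\<close>] by (simp add: iso)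
    also have "l1 u = l1 z" using iso[of u 0] u by (simp add: z_def)
    also have "l1 v = l1 (v' - z)" using iso[of v 0] v by (simp add: z_def)
    also have "\<dots> = l1 v' + l1 z" by (rule l1_diff_star[OF v'(1) z(2) v'(3)])
    finally have "l1 z = 0" using l1_nonneg[of z] by linarith
    with z show False by simp
  qed
  have add: "f (g + h) = f g + f h" for g h using affine[of g h] f0 by simp
  have minus: "f (- g) = - f g" for g using add[of g "- g"] f0 by (simp add: eq_neg_iff_add_eq_0 add.commute)
  have e: "f (axis i 1) = axis i 1" for i
  proof -
    have "f (axis i (int k)) = int k *s f (axis i 1)" for k
    proof (induction k)
      case 0
      have "axis i (int 0) = (0 :: int ^ 'd)" by (simp add: vec_eq_iff axis_def)
      then show ?case by (simp only: f0) simp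
    next
      case (Suc k)
      have "axis i (int (Suc k)) = axis i (int k) + (axis i 1 :: int ^ 'd)"
        by (simp add: vec_eq_iff axis_def)
      then show ?case using Suc by (simp only: add) (simp add: vec_eq_iff algebra_simps)
    qed
    then have "int (leg i) *s f (axis i 1) = f (axis i (int (leg i)))" by simp
    also have "\<dots> = axis i (int (leg i))"
    proof (rule star_l1_eq_leg[OF _ t(2)])
      show "f (axis i (int (leg i))) \<in> star t'"
        using img by (auto simp: star_def)
      show "l1 (f (axis i (int (leg i)))) = int (leg i)"
        using iso[of "axis i (int (leg i))" 0] f0 by simp
    qed
    finally have scaled: "int (leg i) *s f (axis i 1) = axis i (int (leg i))" .
    have "f (axis i 1) $ k = axis i 1 $ k" for k
    proof -
      have "int (leg i) * f (axis i 1) $ k = axis i (int (leg i)) $ k"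
        using arg_cong[OF scaled, of "\<lambda>v. v $ k"] by simp
      also have "\<dots> = int (leg i) * axis i 1 $ k"
        by (simp add: axis_def)
      finally show ?thesis using leg_pos[of i] by simp
    qed
    then show ?thesis by (simp add: vec_eq_iff)
  qed
  show ?thesis
  proof (induction g rule: int_vec_induct)
    case (add g s)
    then show ?case using e by (auto simp: \<open>\<And>g h. f (g + h) = f g + f h\<close> minus standard_generators_def)
  qed (rule f0)
qed

text \<open>The length \<open>t\<close> may vary with the pattern, which provides the room for
  injectivity. The radius \<open>K\<close> of the block will set the spacing of the markers.\<close>

locale block_code =
  fixes n :: nat and B :: "(int ^ 'd) set"
    and \<Phi> :: "(int ^ 'd \<Rightarrow> nat) \<Rightarrow> int ^ 'd \<Rightarrow> nat" and K :: int
  assumes finite_B: "finite B"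
    and inj_code: "inj_on \<Phi> (B \<rightarrow>\<^sub>E {..<n})"
    and code_mem: "p \<in> B \<rightarrow>\<^sub>E {..<n} \<Longrightarrow> \<Phi> p \<in> B \<rightarrow>\<^sub>E {..n}"
    and code_star: "p \<in> B \<rightarrow>\<^sub>E {..<n} \<Longrightarrow> \<exists>t. CARD('d) < t \<and> {b \<in> B. \<Phi> p b = n} = star t"
    and B_bounded: "b \<in> B \<Longrightarrow> l1 b \<le> K"

text \<open>
  There are \<open>n ^ s\<close> stars with at most \<open>s\<close> points each; writing colour \<open>n\<close> on one of them
  leaves the free choice of at least \<open>card B - s\<close> symbols, which makes up for the \<open>n ^ card B\<close>
  patterns to be encoded.
\<close>

lemma ex_block_code: "\<exists>(B :: (int ^ 'd) set) \<Phi> K. block_code n B \<Phi> K"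
proof (cases "n = 0")
  case True
  \<comment> \<open>Over a nonempty block the empty alphabet has no patterns, so the conditions on
    patterns hold vacuously.\<close>
  then have "block_code n {0 :: int ^ 'd} (\<lambda>p. p) 0"
    by unfold_locales (auto simp: PiE_eq_empty_iff)
  then show ?thesis by blast
next
  case False
  define s where "s = CARD('d) + 2"
  \<comment> \<open>Starting above \<open>CARD('d)\<close> keeps the negative leg longer than all
    the others.\<close>
  define T where "T = {CARD('d)<..CARD('d) + n ^ s}"
  define B :: "(int ^ 'd) set" where "B = (\<Union>t\<in>T. star t)"
  define Q where "Q t = (\<Pi>\<^sub>E b\<in>B. if b \<in> star t then {n} else {..<n})" for t
  have finB: "finite B" by (simp add: B_def T_def)
  then have finQ: "finite (Q t)" for t by (auto simp: Q_def intro!: finite_PiE)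
  have sub: "star t \<subseteq> B" if "t \<in> T" for t using that by (auto simp: B_def)
  have support: "{b \<in> B. q b = n} = star t" if "q \<in> Q t" "t \<in> T" for q t
  proof -
    have "q b \<in> (if b \<in> star t then {n} else {..<n})" if "b \<in> B" for b
      using \<open>q \<in> Q t\<close> that unfolding Q_def by (rule PiE_mem)
    then show ?thesis using sub[OF that(2)] by (force split: if_splits)
  qed
  have card_Q: "n ^ (card B - s) \<le> card (Q t)" if "t \<in> T" for t
  proof -
    have "card (Q t) = (\<Prod>b\<in>B. if b \<in> star t then 1 else n)"
      unfolding Q_def by (subst card_PiE[OF finB]) (auto intro!: prod.cong)
    also have "\<dots> = n ^ card (B - star t)"
      using finB by (subst prod.If_cases) (auto simp: Diff_eq)
    also have "card (B - star t) \<ge> card B - s"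
      using card_star_le[of t, where ?'d = 'd] finB sub[OF that] by (subst card_Diff_subset) (auto simp: s_def)
    then have "n ^ (card B - s) \<le> n ^ card (B - star t)"
      using False by (intro power_increasing) auto
    finally show ?thesis .
  qed
  have "card (B \<rightarrow>\<^sub>E {..<n}) = n ^ card B"
    using finB by (simp add: card_PiE)
  \<comment> \<open>Subtraction is truncated, hence an inequality.\<close>
  also have "\<dots> \<le> n ^ (s + (card B - s))"
    using False by (intro power_increasing) auto
  also have "\<dots> = (\<Sum>t\<in>T. n ^ (card B - s))"
    by (simp add: T_def power_add)
  also have "\<dots> \<le> (\<Sum>t\<in>T. card (Q t))"
    by (intro sum_mono card_Q)
  \<comment> \<open>Disjointness: the cells of colour \<open>n\<close> recover the star, and the
    star recovers \<open>t\<close>.\<close>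
  also have "\<dots> = card (\<Union>t\<in>T. Q t)"
  proof (rule card_UN_disjoint[symmetric])
    have "t = t'" if "q \<in> Q t" "q \<in> Q t'" "t \<in> T" "t' \<in> T" for q t t'
      using support[OF that(1,3)] support[OF that(2,4)] that(3,4)
      by (intro star_inj[where ?'d = 'd]) (auto simp: T_def)
    then show "\<forall>t\<in>T. \<forall>t'\<in>T. t \<noteq> t' \<longrightarrow> Q t \<inter> Q t' = {}" by blast
  qed (auto simp: finQ T_def)
  finally obtain \<Phi> where \<Phi>: "\<Phi> ` (B \<rightarrow>\<^sub>E {..<n}) \<subseteq> (\<Union>t\<in>T. Q t)" "inj_on \<Phi> (B \<rightarrow>\<^sub>E {..<n})"
    using card_le_inj[of "B \<rightarrow>\<^sub>E {..<n}" "\<Union>t\<in>T. Q t"] finB finQ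
    by (auto simp: T_def intro: finite_PiE)
  have "block_code n B \<Phi> (\<Sum>b\<in>B. l1 b)"
  proof
    show "finite B" "inj_on \<Phi> (B \<rightarrow>\<^sub>E {..<n})" by fact+
    fix p assume "p \<in> B \<rightarrow>\<^sub>E {..<n}"
    then obtain t where t: "t \<in> T" "\<Phi> p \<in> Q t" using \<Phi>(1) by blast
    then show "\<Phi> p \<in> B \<rightarrow>\<^sub>E {..n}"
      unfolding Q_def by (elim subsetD[rotated]) (intro PiE_mono; auto)
    show "\<exists>t. CARD('d) < t \<and> {b \<in> B. \<Phi> p b = n} = star t"
      using t(1) support[OF t(2,1)] by (intro exI[of _ t]) (simp add: T_def)
  next
    fix b assume "b \<in> B"
    then show "l1 b \<le> (\<Sum>b\<in>B. l1 b)"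
      using finB by (intro member_le_sum) auto
  qed
  then show ?thesis by blast
qed

section \<open>Automorphisms of the Schreier graph\<close>

lemma shift_shift: "shift g (shift h x) = shift (g + h) x"
  by (simp add: shift_def add.assoc)

lemma shift_zero [simp]: "shift 0 x = x"
  by (simp add: shift_def)

lemma shift_in_free_part:
  assumes "x \<in> space (free_part n)"
  shows "shift g x \<in> space (free_part n)"
proof -
  have "shift h (shift g x) \<noteq> shift g x" if "h \<noteq> 0" for h
  proof
    assume "shift h (shift g x) = shift g x"
    then have "shift (- g) (shift (h + g) x) = shift (- g) (shift g x)" by (simp add: shift_shift)
    then have "shift h x = x" by (simp add: shift_shift)
    with assms that show False by (auto simp: space_free_part)
  qed
  with assms show ?thesis by (auto simp: space_free_part shift_def)
qed

lemma shift_eq_iff: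
  assumes "x \<in> space (free_part n)"
  shows "shift g x = shift h x \<longleftrightarrow> g = h"
proof
  assume "shift g x = shift h x"
  then have "shift (- h) (shift g x) = shift (- h) (shift h x)" by simp
  then have "shift (g - h) x = x" by (simp add: shift_shift)
  with assms have "g - h = 0" unfolding space_free_part by blast
  then show "g = h" by simp
qed simp

text \<open>Freeness makes \<open>g \<mapsto> shift g x\<close> an isomorphism from the Cayley graph
  of the grid onto the orbit.\<close>

lemma schreier_edges_shift:
  fixes x :: "int ^ 'd \<Rightarrow> nat"
  assumes "x \<in> space (free_part n)"
  shows "(shift g x, shift h x) \<in> schreier_edges standard_generators n \<longleftrightarrow>
    h - g \<in> standard_generators"
proof -
  have "0 \<notin> (standard_generators :: (int ^ 'd) set)"
    using l1_standard_generator by fastforce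
  moreover have "s + g = h \<longleftrightarrow> s = h - g" for s by (auto simp: algebra_simps)
  ultimately show ?thesis
    using assms by (auto simp: schreier_edges_def shift_in_free_part shift_shift shift_eq_iff)
qed

text \<open>Orbits are connected, so the image can be followed along a path starting at
  \<open>x\<close>.\<close>

lemma automorphism_maps_orbit:
  assumes aut: "graph_automorphism (space (free_part n)) (schreier_edges standard_generators n) \<psi>"
    and x: "x \<in> space (free_part n)"
  shows "\<exists>h. \<psi> (shift g x) = shift h (\<psi> x)"
proof (induction g rule: int_vec_induct)
  case zero
  show ?case by (intro exI[of _ 0]) simp
next
  case (add g s)
  then obtain h where h: "\<psi> (shift g x) = shift h (\<psi> x)" by blast
  have "(shift g x, shift (g + s) x) \<in> schreier_edges standard_generators n"
    using schreier_edges_shift[OF x] add(2) by simp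
  then have "(\<psi> (shift g x), \<psi> (shift (g + s) x)) \<in> schreier_edges standard_generators n"
    using aut x shift_in_free_part unfolding graph_automorphism_def by blast
  then obtain s' where "shift s' (shift h (\<psi> x)) = \<psi> (shift (g + s) x)"
    by (auto simp: schreier_edges_def h)
  then show ?case unfolding shift_shift by metis
qed

lemma graph_automorphism_inv:
  assumes "graph_automorphism X E \<psi>"
  shows "graph_automorphism X E (inv_into X \<psi>)"
proof -
  have bij: "bij_betw \<psi> X X" using assms by (simp add: graph_automorphism_def)
  have "inv_into X \<psi> x \<in> X" "\<psi> (inv_into X \<psi> x) = x" if "x \<in> X" for x
    using bij that by (auto simp: bij_betw_def inv_into_into f_inv_into_f)
  with assms show ?thesis
    unfolding graph_automorphism_def by (metis bij_betw_inv_into)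
qed

text \<open>This transfers automorphisms to the grid. The inverse automorphism, followed from
  \<open>\<psi> x\<close>, yields the inverse of \<open>\<phi>\<close>.\<close>

lemma automorphism_on_orbit:
  fixes x :: "int ^ 'd \<Rightarrow> nat"
  assumes aut: "graph_automorphism (space (free_part n)) (schreier_edges standard_generators n) \<psi>"
    and x: "x \<in> space (free_part n)"
  obtains \<phi> where "bij \<phi>" "\<And>g. \<psi> (shift g x) = shift (\<phi> g) (\<psi> x)"
    "\<And>g h. \<phi> g - \<phi> h \<in> standard_generators \<longleftrightarrow> g - h \<in> standard_generators"
proof -
  let ?X = "space (free_part n) :: (int ^ 'd \<Rightarrow> nat) set"
  define y where "y = \<psi> x"
  have bij: "bij_betw \<psi> ?X ?X" using aut by (simp add: graph_automorphism_def)
  then have y: "y \<in> ?X" using x by (auto simp: y_def bij_betw_def)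
  obtain \<phi> where \<phi>: "\<And>g. \<psi> (shift g x) = shift (\<phi> g) y"
    using automorphism_maps_orbit[OF aut x] unfolding y_def by metis
  have "inv_into ?X \<psi> y = x"
    using bij x by (simp add: y_def bij_betw_def)
  then obtain \<phi>' where \<phi>': "\<And>g. inv_into ?X \<psi> (shift g y) = shift (\<phi>' g) x"
    using automorphism_maps_orbit[OF graph_automorphism_inv[OF aut] y] by metis
  have "shift (\<phi> (\<phi>' g)) y = shift g y" for g
    using bij shift_in_free_part[OF y, of g]
    by (metis \<phi> \<phi>' bij_betw_inv_into_right)
  then have 1: "\<phi> (\<phi>' g) = g" for g by (simp add: shift_eq_iff[OF y])
  have "shift (\<phi>' (\<phi> g)) x = shift g x" for g
    using bij shift_in_free_part[OF x, of g]
    by (metis \<phi> \<phi>' bij_betw_inv_into_left)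
  then have 2: "\<phi>' (\<phi> g) = g" for g by (simp add: shift_eq_iff[OF x])
  have "bij \<phi>" using 1 2 by (metis bijI')
  moreover have "\<phi> g - \<phi> h \<in> standard_generators \<longleftrightarrow> g - h \<in> standard_generators" for g h
    using aut shift_in_free_part[OF x] schreier_edges_shift[OF x, of h g]
      schreier_edges_shift[OF y, of "\<phi> h" "\<phi> g"]
    unfolding graph_automorphism_def \<phi>[symmetric] by blast
  ultimately show ?thesis using that \<phi> unfolding y_def by blast
qed

section \<open>Borel markers\<close>

text \<open>A list codes a finite partial configuration. There are countably many, so
  \<open>to_nat\<close> ranks them and quantifying over them keeps sets Borel.\<close>

definition matches :: "('a \<times> 'b) list \<Rightarrow> ('a \<Rightarrow> 'b) \<Rightarrow> bool" where
  "matches l x \<longleftrightarrow> (\<forall>(h, v)\<in>set l. x h = v)"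

definition isolated :: "int \<Rightarrow> ((int ^ 'd) \<times> nat) list \<Rightarrow> (int ^ 'd \<Rightarrow> nat) \<Rightarrow> bool" where
  "isolated R l x \<longleftrightarrow> matches l x \<and> (\<forall>g. g \<noteq> 0 \<longrightarrow> l1 g \<le> R \<longrightarrow> \<not> matches l (shift g x))"

text \<open>
  The pattern witnessing a marker is the first isolated pattern occurring in the orbit, so all
  markers in an orbit share it, which keeps them apart.
\<close>

definition marker :: "int \<Rightarrow> (int ^ 'd \<Rightarrow> nat) \<Rightarrow> bool" where
  "marker R x \<longleftrightarrow> (\<exists>l. isolated R l x \<and>
     (\<forall>l' g. to_nat l' < to_nat l \<longrightarrow> \<not> isolated R l' (shift g x)))"

lemma marker_separated:
  assumes "marker R (shift g x)" "marker R (shift h x)" "l1 (g - h) \<le> R"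
  shows "g = h"
proof -
  have "\<exists>l. isolated R l (shift g x) \<and> (\<forall>l' k. to_nat l' < to_nat l \<longrightarrow> \<not> isolated R l' (shift k x))"
    if "marker R (shift g x)" for g
  proof -
    obtain l where l: "isolated R l (shift g x)"
      "\<And>l' k. to_nat l' < to_nat l \<Longrightarrow> \<not> isolated R l' (shift (k + g) x)"
      using \<open>marker R (shift g x)\<close> unfolding marker_def shift_shift by blast
    \<comment> \<open>Minimality of \<open>l\<close> is a property of the orbit, so it can be stated
      from the base point \<open>x\<close>.\<close>
    have "\<not> isolated R l' (shift k x)" if "to_nat l' < to_nat l" for l' k
      using l(2)[OF that, of "k - g"] by simp
    with l(1) show ?thesis by blast
  qed
  from this[OF assms(1)] this[OF assms(2)]
  obtain l l' where l: "isolated R l (shift g x)" "isolated R l' (shift h x)"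
    "\<not> to_nat l' < to_nat l" "\<not> to_nat l < to_nat l'" by metis
  then have "l = l'" by (simp add: nat_neq_iff[symmetric])
  then have "matches l (shift (g - h) (shift h x))"
    using l(1) by (simp add: shift_shift isolated_def)
  then have "g - h = 0" using l(2) \<open>l = l'\<close> assms(3) unfolding isolated_def by blast
  then show ?thesis by simp
qed

text \<open>By freeness each nonzero \<open>g\<close> in the finite ball moves some value of
  \<open>x\<close>. Prescribing \<open>x\<close> at these finitely many places excludes all the
  nearby translates.\<close>

lemma ex_isolated:
  fixes x :: "int ^ 'd \<Rightarrow> nat"
  assumes "x \<in> space (free_part n)"
  shows "\<exists>l. isolated R l x"
proof -
  let ?G = "{g :: int ^ 'd. l1 g \<le> R} - {0}"
  have "\<forall>g\<in>?G. \<exists>h. x (h + g) \<noteq> x h"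
    using assms by (auto simp: space_free_part shift_def fun_eq_iff)
  then obtain p where p: "\<And>g. g \<in> ?G \<Longrightarrow> x (p g + g) \<noteq> x (p g)" by metis
  have "finite ((\<lambda>g. (p g, x (p g))) ` ?G)"
    by (intro finite_imageI finite_Diff finite_l1_ball)
  from finite_list[OF this] obtain l where l: "set l = (\<lambda>g. (p g, x (p g))) ` ?G" ..
  have "isolated R l x"
    using p by (auto simp: isolated_def matches_def l shift_def)
  then show ?thesis by blast
qed

text \<open>Some isolated pattern occurs in the orbit, hence one of least rank does.\<close>

lemma ex_marker:
  fixes x :: "int ^ 'd \<Rightarrow> nat"
  assumes "x \<in> space (free_part n)"
  shows "\<exists>g. marker R (shift g x)"
proof -
  let ?P = "\<lambda>k. \<exists>l g. to_nat l = k \<and> isolated R l (shift g x)"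
  obtain l0 where "isolated R l0 (shift 0 x)" using ex_isolated[OF assms] by auto
  then have "?P (to_nat l0)" by blast
  then have "?P (LEAST k. ?P k)" by (rule LeastI)
  then obtain l g where l: "to_nat l = (LEAST k. ?P k)" "isolated R l (shift g x)" by blast
  have "\<not> isolated R l' (shift h (shift g x))" if "to_nat l' < to_nat l" for l' h
    using not_less_Least[of "to_nat l'" ?P] that unfolding l(1) shift_shift by blast
  with l(2) show ?thesis unfolding marker_def by blast
qed

lemma measurable_free_part_coordinate:
  "(\<lambda>x. x h) \<in> measurable (free_part n) (count_space UNIV)"
  unfolding free_part_def config_space_def
  by (rule measurable_restrict_space1, rule measurable_compose[OF measurable_component_singleton])
     (auto simp: measurable_count_space_eq1)

lemma measurable_pred_coordinate [measurable]:
  "Measurable.pred (free_part n) (\<lambda>x. x h = v)"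
  by (rule pred_eq_const1[OF measurable_free_part_coordinate]) simp

lemma measurable_matches:
  fixes l :: "((int ^ 'd) \<times> nat) list"
  shows "Measurable.pred (free_part n) (\<lambda>x. matches l (shift g x))"
  unfolding matches_def shift_def case_prod_beta
  by (intro pred_intros_finite measurable_pred_coordinate) auto

lemma measurable_isolated:
  "Measurable.pred (free_part n) (\<lambda>x. isolated R l (shift g x))"
  unfolding isolated_def shift_shift
  by (intro pred_intros_logic pred_intros_countable measurable_matches) auto

text \<open>Patterns and group elements are countable, so the quantifiers are countable unions and
  intersections.\<close>

lemma measurable_marker:
  "Measurable.pred (free_part n) (\<lambda>x. marker R (shift g x))"
  unfolding marker_def shift_shift
  by (intro pred_intros_logic pred_intros_countable measurable_isolated) auto

section \<open>The distinguishing colouring\<close>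

context block_code
begin

text \<open>If two blocks contain points at distance at most \<open>2 * K\<close>, their markers are
  within \<open>4 * K\<close>. With this spacing distinct blocks are more than \<open>2 * K\<close>
  apart.\<close>

definition block_marker :: "(int ^ 'd \<Rightarrow> nat) \<Rightarrow> bool" where
  "block_marker = marker (4 * K)"

definition block_colour :: "(int ^ 'd \<Rightarrow> nat) \<Rightarrow> int ^ 'd \<Rightarrow> nat" where
  "block_colour x = \<Phi> (restrict x B)"

text \<open>The origin of \<open>x\<close> occupies position \<open>- m\<close> in the block of a
  marker at \<open>m\<close>. The description is proper because distinct blocks are
  disjoint.\<close>

definition colouring :: "(int ^ 'd \<Rightarrow> nat) \<Rightarrow> nat" where
  "colouring x =
     (if \<exists>m. block_marker (shift m x) \<and> - m \<in> B
      then let m = THE m. block_marker (shift m x) \<and> - m \<in> B in block_colour (shift m x) (- m)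
      else x 0)"

lemma block_marker_unique:
  assumes m: "block_marker (shift m x)" "block_marker (shift m' x)"
    and b: "b \<in> B" "b' \<in> B" and near: "l1 ((m + b) - (m' + b')) \<le> 2 * K"
  shows "m = m'"
proof -
  have "l1 (m - m') \<le> l1 ((m + b) - (m' + b')) + l1 (b' - b)"
    using l1_triangle[of "(m + b) - (m' + b')" "b' - b"] by (simp add: algebra_simps)
  also have "l1 (b' - b) \<le> K + K"
    using l1_triangle_minus[of b' b] B_bounded[OF b(1)] B_bounded[OF b(2)] by linarith
  finally show ?thesis
    using marker_separated[OF m[unfolded block_marker_def]] near by simp
qed

lemma block_marker_unique_block:
  assumes "block_marker (shift m x)" "block_marker (shift m' x)" "h - m \<in> B" "h - m' \<in> B"
  shows "m = m'"
proof (rule block_marker_unique[OF assms])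
  \<comment> \<open>Nonnegativity of \<open>K\<close> comes from a point of the block.\<close>
  have "0 \<le> K" using B_bounded[OF assms(3)] l1_nonneg[of "h - m"] by linarith
  then show "l1 (m + (h - m) - (m' + (h - m'))) \<le> 2 * K" by simp
qed

lemma colouring_block:
  assumes "block_marker (shift m x)" "b \<in> B"
  shows "colouring (shift (m + b) x) = block_colour (shift m x) b"
proof -
  let ?P = "\<lambda>k. block_marker (shift k (shift (m + b) x)) \<and> - k \<in> B"
  have P: "?P (- b)" using assms by (simp add: shift_shift)
  have "k = - b" if "?P k" for k
    using block_marker_unique_block[of k "shift (m + b) x" "- b" 0] P that by simp
  with P have "(THE k. ?P k) = - b" by (rule the_equality)
  moreover have "\<exists>k. ?P k" using P by blast
  ultimately have "colouring (shift (m + b) x) = block_colour (shift (- b) (shift (m + b) x)) (- (- b))"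
    unfolding colouring_def by (simp only: Let_def if_True)
  then show ?thesis by (simp add: shift_shift)
qed

lemma colouring_outside:
  assumes "\<And>m. block_marker (shift m x) \<Longrightarrow> h - m \<notin> B"
  shows "colouring (shift h x) = x h"
proof -
  have "- k \<notin> B" if "block_marker (shift k (shift h x))" for k
    using assms[of "k + h"] that by (simp add: shift_shift)
  then have "\<not> (\<exists>k. block_marker (shift k (shift h x)) \<and> - k \<in> B)" by blast
  then have "colouring (shift h x) = shift h x 0" unfolding colouring_def by (simp only: if_False)
  then show ?thesis by (simp add: shift_def)
qed

lemma restrict_mem:
  assumes "x \<in> space (free_part n)"
  shows "restrict x B \<in> B \<rightarrow>\<^sub>E {..<n}"
  using assms by (auto simp: space_free_part)

lemma colouring_cases:
  obtains m where "block_marker (shift m x)" "h - m \<in> B"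
      "colouring (shift h x) = block_colour (shift m x) (h - m)"
  | "\<And>m. block_marker (shift m x) \<Longrightarrow> h - m \<notin> B" "colouring (shift h x) = x h"
proof (cases "\<exists>m. block_marker (shift m x) \<and> h - m \<in> B")
  case True
  then obtain m where "block_marker (shift m x)" "h - m \<in> B" by blast
  with colouring_block[OF this] that(1) show ?thesis by simp
next
  case False
  with colouring_outside[of x h] that(2) show ?thesis by blast
qed

lemma colouring_le:
  assumes "x \<in> space (free_part n)"
  shows "colouring x \<le> n"
proof (cases rule: colouring_cases[of x 0])
  case (1 m)
  have "block_colour (shift m x) \<in> B \<rightarrow>\<^sub>E {..n}"
    unfolding block_colour_def by (intro code_mem restrict_mem shift_in_free_part assms)
  from PiE_mem[OF this 1(2)] 1(3) show ?thesis by simp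
next
  case 2
  with assms show ?thesis by (simp add: space_free_part less_imp_le)
qed

section \<open>Recovering stars and configurations from the colours\<close>

definition marked_star :: "(int ^ 'd \<Rightarrow> nat) \<Rightarrow> (int ^ 'd) set" where
  "marked_star x = {b \<in> B. block_colour x b = n}"

lemma marked_star_eq:
  assumes "x \<in> space (free_part n)"
  shows "\<exists>t. CARD('d) < t \<and> marked_star x = star t"
  unfolding marked_star_def block_colour_def by (rule code_star[OF restrict_mem[OF assms]])

text \<open>Outside the blocks the colours are symbols of \<open>x\<close>, all below
  \<open>n\<close>.\<close>

lemma colouring_eq_n_iff:
  assumes "x \<in> space (free_part n)"
  shows "colouring (shift h x) = n \<longleftrightarrow>
    (\<exists>m. block_marker (shift m x) \<and> h - m \<in> marked_star (shift m x))"
proof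
  assume *: "colouring (shift h x) = n"
  show "\<exists>m. block_marker (shift m x) \<and> h - m \<in> marked_star (shift m x)"
  proof (cases rule: colouring_cases[of x h])
    case (1 m)
    with * show ?thesis by (auto simp: marked_star_def)
  next
    case 2
    with * assms have False by (auto simp: space_free_part)
    then show ?thesis ..
  qed
next
  assume "\<exists>m. block_marker (shift m x) \<and> h - m \<in> marked_star (shift m x)"
  then obtain m where "block_marker (shift m x)" "h - m \<in> B" "block_colour (shift m x) (h - m) = n"
    by (auto simp: marked_star_def)
  with colouring_block[OF this(1,2)] show "colouring (shift h x) = n" by simp
qed

text \<open>A star has diameter at most \<open>2 * K\<close>, while distinct stars are farther apart
  than that. Thus colour and distance alone recover a star, and isometries preserving the colours
  respect stars.\<close>

lemma colouring_cluster:
  assumes x: "x \<in> space (free_part n)" and m: "block_marker (shift m x)"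
    and b: "b \<in> marked_star (shift m x)"
  shows "colouring (shift h x) = n \<and> l1 (h - (m + b)) \<le> 2 * K \<longleftrightarrow>
    h - m \<in> marked_star (shift m x)"
proof
  assume *: "colouring (shift h x) = n \<and> l1 (h - (m + b)) \<le> 2 * K"
  then obtain m' where m': "block_marker (shift m' x)" "h - m' \<in> marked_star (shift m' x)"
    using colouring_eq_n_iff[OF x] by blast
  then have "m' = m"
    using block_marker_unique[of m' x m "h - m'" b] m b * by (auto simp: marked_star_def)
  with m' show "h - m \<in> marked_star (shift m x)" by simp
next
  assume *: "h - m \<in> marked_star (shift m x)"
  then have "l1 (h - m) \<le> K" "l1 b \<le> K" using b by (auto simp: marked_star_def B_bounded)
  moreover have "l1 (h - (m + b)) \<le> l1 (h - m) + l1 b"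
    using l1_triangle_minus[of "h - m" b] by (simp add: algebra_simps)
  ultimately show "colouring (shift h x) = n \<and> l1 (h - (m + b)) \<le> 2 * K"
    using * m colouring_eq_n_iff[OF x] by auto
qed

text \<open>Rigidity of stars makes \<open>f\<close> a translation matching the markers of
  \<open>x\<close> with those of \<open>y\<close>. Equal colours then give equal codes on blocks,
  which are decoded by injectivity of \<open>\<Phi>\<close>; off the blocks the colours are the
  symbols themselves.\<close>

lemma colouring_determines_orbit_map:
  fixes f :: "int ^ 'd \<Rightarrow> int ^ 'd"
  assumes x: "x \<in> space (free_part n)" and y: "y \<in> space (free_part n)"
    and bij: "bij f" and affine: "\<And>g h. f (g + h) = f g + f h - f 0"
    and iso: "\<And>g h. l1 (f g - f h) = l1 (g - h)"
    and col: "\<And>g. colouring (shift g x) = colouring (shift (f g) y)"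
  shows "shift (f g) y = shift g x"
proof -
  \<comment> \<open>It suffices that one point of a star lands in a star; neither point has to be
    the centre.\<close>
  have translate: "f (m + u) = m' + u"
    if m: "block_marker (shift m x)" and m': "block_marker (shift m' y)"
      and b: "b \<in> marked_star (shift m x)" and b': "b' \<in> marked_star (shift m' y)"
      and fb: "f (m + b) = m' + b'" for m m' b b' u
  proof -
    \<comment> \<open>\<open>f\<close> in coordinates centred at the two markers.\<close>
    define f' where "f' u = f (m + u) - m'" for u
    obtain t t' where t: "CARD('d) < t" "marked_star (shift m x) = star t"
      "CARD('d) < t'" "marked_star (shift m' y) = star t'"
      using marked_star_eq shift_in_free_part x y by metis
    have mem: "u \<in> star t \<longleftrightarrow> f' u \<in> star t'" for u
    proof -
      have "u \<in> star t \<longleftrightarrow> colouring (shift (m + u) x) = n \<and> l1 ((m + u) - (m + b)) \<le> 2 * K"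
        using colouring_cluster[OF x m b, of "m + u"] t by simp
      also have "\<dots> \<longleftrightarrow> colouring (shift (f (m + u)) y) = n \<and> l1 (f (m + u) - (m' + b')) \<le> 2 * K"
        unfolding col fb[symmetric] iso ..
      also have "\<dots> \<longleftrightarrow> f' u \<in> star t'"
        using colouring_cluster[OF y m' b', of "f (m + u)"] t by (simp add: f'_def)
      finally show ?thesis .
    qed
    have "f' ` star t = star t'"
    proof (intro set_eqI iffI)
      fix v :: "int ^ 'd" assume v: "v \<in> star t'"
      obtain k where k: "f k = m' + v" using bij by (metis bij_pointE)
      have "f' (k - m) = v" by (simp add: f'_def k)
      with v mem show "v \<in> f' ` star t" by (metis imageI)
    qed (use mem in auto)
    moreover have "f' (g + h) = f' g + f' h - f' 0" for g h
    proof -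
      have "f (m + (g + h)) = f (m + g) + (f (m + h) - f m)"
        unfolding affine[of m h] using affine[of "m + g" h] by (simp add: add.assoc)
      then show ?thesis by (simp add: f'_def)
    qed
    moreover have "l1 (f' g - f' h) = l1 (g - h)" for g h
      using iso[of "m + g" "m + h"] by (simp add: f'_def)
    ultimately have "f' u = u" using star_rigid t(1,3) by metis
    then show ?thesis by (simp add: f'_def algebra_simps)
  qed
  have zero: "0 \<in> marked_star (shift m z)" if "z \<in> space (free_part n)" for m z
    using marked_star_eq[OF shift_in_free_part[OF that]] zero_in_star by metis
  have fwd: "\<exists>m'. block_marker (shift m' y) \<and> (\<forall>u. f (m + u) = m' + u)"
    if m: "block_marker (shift m x)" for m
  proof -
    \<comment> \<open>The centre has colour \<open>n\<close>, so its image lies somewhere in a star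
      of \<open>y\<close>.\<close>
    have "colouring (shift m x) = n"
      unfolding colouring_eq_n_iff[OF x] using m zero[OF x, of m] by (intro exI[of _ m]) simp
    then obtain m' where m': "block_marker (shift m' y)" "f m - m' \<in> marked_star (shift m' y)"
      unfolding col colouring_eq_n_iff[OF y] by blast
    have "f (m + u) = m' + u" for u
      using translate[OF m m'(1) zero[OF x] m'(2)] by simp
    with m' show ?thesis by blast
  qed
  have bwd: "\<exists>m. block_marker (shift m x) \<and> (\<forall>u. f (m + u) = m' + u)"
    if m': "block_marker (shift m' y)" for m'
  proof -
    obtain k where k: "f k = m'" using bij by (metis bij_pointE)
    have "colouring (shift m' y) = n"
      unfolding colouring_eq_n_iff[OF y] using m' zero[OF y, of m'] by (intro exI[of _ m']) simp
    then have "colouring (shift k x) = n" by (simp add: col k)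
    then obtain m where m: "block_marker (shift m x)" "k - m \<in> marked_star (shift m x)"
      unfolding colouring_eq_n_iff[OF x] by blast
    have "f (m + u) = m' + u" for u
      using translate[OF m(1) m' m(2) zero[OF y]] k by simp
    with m show ?thesis by blast
  qed
  define w where "w = f 0"
  \<comment> \<open>A single marker in the orbit already makes \<open>f\<close> a
    translation.\<close>
  have f: "f k = k + w" for k
  proof -
    obtain m where "block_marker (shift m x)"
      using ex_marker[OF x] unfolding block_marker_def by blast
    from fwd[OF this] obtain m' where *: "\<And>u. f (m + u) = m' + u" by blast
    show ?thesis using *[of "k - m"] *[of "- m"] by (simp add: w_def)
  qed
  have markers: "block_marker (shift (m + w) y) \<longleftrightarrow> block_marker (shift m x)" for m
  proof
    assume "block_marker (shift m x)"
    from fwd[OF this] obtain m' where *: "block_marker (shift m' y)" "\<And>u. f (m + u) = m' + u" by blast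
    from *(2)[of 0] have "m' = m + w" by (simp add: f)
    with * show "block_marker (shift (m + w) y)" by simp
  next
    assume "block_marker (shift (m + w) y)"
    from bwd[OF this] obtain m' where
      *: "block_marker (shift m' x)" "\<And>u. f (m' + u) = m + w + u" by blast
    from *(2)[of 0] have "m' = m" by (simp add: f)
    with * show "block_marker (shift m x)" by simp
  qed
  have "x h = y (h + w)" for h
  proof (cases rule: colouring_cases[of x h])
    case (1 m)
    have m': "block_marker (shift (m + w) y)" using 1 markers by simp
    have mem: "restrict (shift m x) B \<in> B \<rightarrow>\<^sub>E {..<n}" "restrict (shift (m + w) y) B \<in> B \<rightarrow>\<^sub>E {..<n}"
      by (intro restrict_mem shift_in_free_part x y)+
    have "block_colour (shift m x) = block_colour (shift (m + w) y)"
      unfolding block_colour_def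
    proof (rule PiE_ext[OF code_mem code_mem, OF mem])
      fix b assume b: "b \<in> B"
      have "m + b + w = m + w + b" by (simp add: algebra_simps)
      with colouring_block[OF 1(1) b] colouring_block[OF m' b] col[of "m + b"]
      show "\<Phi> (restrict (shift m x) B) b = \<Phi> (restrict (shift (m + w) y) B) b"
        by (simp add: f block_colour_def)
    qed
    then have "restrict (shift m x) B = restrict (shift (m + w) y) B"
      unfolding block_colour_def using inj_code mem by (meson inj_onD)
    from fun_cong[OF this, of "h - m"] 1(2) show ?thesis
      by (simp add: shift_def algebra_simps)
  next
    case 2
    \<comment> \<open>Since markers correspond under translation by \<open>w\<close>, the cell
      \<open>h + w\<close> of \<open>y\<close> is also outside all blocks.\<close>
    have "h + w - m \<notin> B" if "block_marker (shift m y)" for m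
      using 2(1)[of "m - w"] markers[of "m - w"] that by (simp add: algebra_simps)
    from colouring_outside[OF this] 2(2) col[of h] show ?thesis by (simp add: f)
  qed
  then show ?thesis by (simp add: shift_def f fun_eq_iff algebra_simps)
qed

text \<open>Each fibre is described without the description operator: finite disjunctions run over
  the position in a block and the pattern on it.\<close>

lemma measurable_colouring:
  "colouring \<in> measurable (free_part n) (count_space {..n})"
proof -
  have finP: "finite (B \<rightarrow>\<^sub>E {..<n})" using finite_B by (intro finite_PiE) auto
  have "colouring x = v \<longleftrightarrow>
      (\<exists>b\<in>B. block_marker (shift (- b) x) \<and>
         (\<exists>p\<in>B \<rightarrow>\<^sub>E {..<n}. (\<forall>k\<in>B. x (k - b) = p k) \<and> \<Phi> p b = v)) \<or>
      (\<forall>b\<in>B. \<not> block_marker (shift (- b) x)) \<and> x 0 = v"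
    if x: "x \<in> space (free_part n)" for x v
  proof -
    have code: "(\<exists>p\<in>B \<rightarrow>\<^sub>E {..<n}. (\<forall>k\<in>B. x (k - b) = p k) \<and> \<Phi> p b = v) \<longleftrightarrow>
        block_colour (shift (- b) x) b = v" for b
    proof -
      have mem: "restrict (shift (- b) x) B \<in> B \<rightarrow>\<^sub>E {..<n}"
        by (intro restrict_mem shift_in_free_part x)
      have "p = restrict (shift (- b) x) B" if "p \<in> B \<rightarrow>\<^sub>E {..<n}" "\<forall>k\<in>B. x (k - b) = p k" for p
        using that by (intro PiE_ext[OF that(1) mem]) (simp add: shift_def)
      moreover have "\<forall>k\<in>B. x (k - b) = restrict (shift (- b) x) B k" by (simp add: shift_def)
      ultimately show ?thesis unfolding block_colour_def using mem by metis
    qed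
    show ?thesis
    proof (cases rule: colouring_cases[of x 0])
      case (1 m)
      have "b = - m" if "b \<in> B" "block_marker (shift (- b) x)" for b
        using block_marker_unique_block[OF that(2) 1(1), of 0] 1(2) that(1) by auto
      moreover have "- m \<in> B" "block_marker (shift (- (- m)) x)"
        "colouring x = block_colour (shift (- (- m)) x) (- m)"
        using 1 by simp_all
      ultimately show ?thesis unfolding code by metis
    next
      case 2
      have "\<not> block_marker (shift (- b) x)" if "b \<in> B" for b
        using 2(1)[of "- b"] that by auto
      with 2(2) show ?thesis unfolding code by auto
    qed
  qed
  moreover have "Measurable.pred (free_part n) (\<lambda>x.
      (\<exists>b\<in>B. block_marker (shift (- b) x) \<and>
         (\<exists>p\<in>B \<rightarrow>\<^sub>E {..<n}. (\<forall>k\<in>B. x (k - b) = p k) \<and> \<Phi> p b = v)) \<or>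
      (\<forall>b\<in>B. \<not> block_marker (shift (- b) x)) \<and> x 0 = v)" for v
    unfolding block_marker_def
    by (intro pred_intros_logic pred_intros_finite finite_B finP measurable_marker
        measurable_pred_coordinate) auto
  ultimately have "Measurable.pred (free_part n) (\<lambda>x. colouring x = v)" for v
    by (simp cong: measurable_cong)
  then have "colouring -` {v} \<inter> space (free_part n) \<in> sets (free_part n)" for v
    by (simp add: pred_def vimage_def Int_def conj_commute)
  then show ?thesis
    using colouring_le by (subst measurable_count_space_eq2) auto
qed

lemma colouring_distinguishing:
  assumes aut: "graph_automorphism (space (free_part n)) (schreier_edges standard_generators n) \<psi>"
    and col: "\<And>x. x \<in> space (free_part n) \<Longrightarrow> colouring (\<psi> x) = colouring x"
    and x: "x \<in> space (free_part n)"
  shows "\<psi> x = x"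
proof -
  have y: "\<psi> x \<in> space (free_part n)"
    using aut x by (auto simp: graph_automorphism_def bij_betw_def)
  obtain f where f: "bij f" "\<And>g. \<psi> (shift g x) = shift (f g) (\<psi> x)"
    "\<And>g h. f g - f h \<in> standard_generators \<longleftrightarrow> g - h \<in> standard_generators"
    using automorphism_on_orbit[OF aut x] by blast
  have "shift (f 0) (\<psi> x) = shift 0 x"
    using x y f(1)
  proof (rule colouring_determines_orbit_map)
    show "f (g + h) = f g + f h - f 0" for g h by (rule grid_automorphism_affine[OF f(1,3)])
    show "l1 (f g - f h) = l1 (g - h)" for g h by (rule grid_automorphism_isometry[OF f(1,3)])
    show "colouring (shift g x) = colouring (shift (f g) (\<psi> x))" for g
      using col[OF shift_in_free_part[OF x]] by (simp add: f(2))
  qed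
  then show ?thesis using f(2)[of 0] by simp
qed

end

section \<open>The bound on the Borel distinguishing number\<close>

lemma standard_borel_count_space:
  assumes "countable A"
  shows "standard_borel (count_space A)"
  unfolding standard_borel_def
proof (intro exI[of _ "discrete_topology A"] conjI)
  have "sigma_sets A (Pow A) = Pow A"
    using sigma_algebra.sigma_sets_eq[OF sigma_algebra_Pow] .
  then show "sets (count_space A) =
      sigma_sets (topspace (discrete_topology A)) {U. openin (discrete_topology A) U}"
    by (simp add: Pow_def)
qed (use assms in \<open>auto simp: completely_metrizable_space_discrete_topology
  second_countable_discrete_topology\<close>)

theorem theorem1p3:
  fixes n :: nat
  assumes "n \<ge> 2"
  shows "borel_distinguishing_number (free_part n :: (int ^ 'd \<Rightarrow> nat) measure)
           (schreier_edges standard_generators n) \<le>o |{..<n + 1}|"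
proof -
  let ?M = "free_part n :: (int ^ 'd \<Rightarrow> nat) measure"
  \<comment> \<open>The \<open>n + 1\<close> colours \<open>0, ..., n\<close> are moved into the
    reals, where colour spaces have their carriers.\<close>
  let ?Y = "count_space (real ` {..n})"
  obtain B :: "(int ^ 'd) set" and \<Phi> K where "block_code n B \<Phi> K"
    using ex_block_code by blast
  then interpret block_code n B \<Phi> K .
  have "borel_distinguishing_coloring ?M (schreier_edges standard_generators n) ?Y
      (\<lambda>x. real (colouring x))"
    unfolding borel_distinguishing_coloring_def
  proof (intro conjI allI impI)
    show "standard_borel ?Y" by (intro standard_borel_count_space) auto
    show "(\<lambda>x. real (colouring x)) \<in> measurable ?M ?Y"
      by (rule measurable_compose[OF measurable_colouring]) auto
    show "\<exists>x\<in>space ?M. real (colouring (\<psi> x)) \<noteq> real (colouring x)"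
      if "graph_automorphism (space ?M) (schreier_edges standard_generators n) \<psi>"
        "\<exists>x\<in>space ?M. \<psi> x \<noteq> x" for \<psi>
      using colouring_distinguishing[OF that(1)] that(2) by auto
  qed
  then have "|space ?Y| \<in> borel_distinguishing_cardinals ?M (schreier_edges standard_generators n)"
    unfolding borel_distinguishing_cardinals_def by blast
  then have "borel_distinguishing_number ?M (schreier_edges standard_generators n) \<le>o |space ?Y|"
    using borel_distinguishing_number_minimum(2) by blast
  also have "|space ?Y| \<le>o |{..<n + 1}|"
    using card_of_image[of real "{..n}"] by (simp add: lessThan_Suc_atMost)
  finally show ?thesis .
qed

end
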